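(* Let $N\ge2$ and $q=e^{\mathrm i\pi/N}$. Let $\mathcal W_0,\mathcal W_1$ be a cyclic tridiagonal pair of cyclicity $N$ on a finite-dimensional complex vector space $V$ such that, for standard orderings of the eigenspaces, the eigenvalue of $\mathcal W_0$ on $V_t$ is $\theta_t=bq^{2t}+cq^{-2t}$ and the eigenvalue of $\mathcal W_1$ on $V_t^*$ is $\theta^*_t=b^*q^{2t}+c^*q^{-2t}$, $t=0,\dots,N-1$, with $b,c,b^*,c^*\in\mathbb C$. Put $\rho=-bc(q^2-q^{-2})^2$, $\rho^*=-b^*c^*(q^2-q^{-2})^2$. Then for every integer $r$ with $1\le r\le N-1$, $\mathcal W_0,\mathcal W_1$ satisfy the $r$-th higher-order $q$-Dolan–Grady relations $$\sum_{p=0}^{r}\sum_{j=0}^{2r+1-2p}(-1)^{j+p}\rho^{p}\,c_j^{[r,p]}\,\mathcal W_0^{2r+1-2p-j}\,\mathcal W_1^{r}\,\mathcal W_0^{j}=0,$$ $$\sum_{p=0}^{r}\sum_{j=0}^{2r+1-2p}(-1)^{j+p}(\rho^* )^{p}\,c_j^{[r,p]}\,\mathcal W_1^{2r+1-2p-j}\,\mathcal W_0^{r}\,\mathcal W_1^{j}=0.$$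
   Context: Cyclic tridiagonal pair of cyclicity $N$ on $V$: an ordered pair of linear maps $C,C^*:V\to V$ such that (i) each is diagonalizable; (ii) there is an ordering $\{V_p\}_{p\in\mathbb Z_N}$ (with $\mathbb Z_N=\mathbb Z/N\mathbb Z$) of the eigenspaces of $C$ with $C^*V_p\subseteq V_{p-1}+V_p+V_{p+1}$; (iii) there is an ordering $\{V^*_p\}_{p\in\mathbb Z_N}$ of the eigenspaces of $C^*$ with $CV^*_p\subseteq V^*_{p-1}+V^*_p+V^*_{p+1}$; (iv) there is no subspace $W\ne0,V$ with $CW\subseteq W$, $C^*W\subseteq W$. Orderings as in (ii), (iii) are called standard. The coefficients $c_j^{[r,p]}$ ($0\le p\le r$, $0\le j\le 2r+1-2p$) are the polynomials in $q^{\pm1}$, independent of $\varrho$, defined by the polynomial identity in commuting indeterminates $x,y,\varrho$ $$(x-y)\prod_{s=1}^{r}\Bigl(x^2-\tfrac{[2s]_{q^2}}{[s]_{q^2}}\,xy+y^2-[s]_{q^2}^2\,\varrho\Bigr)=\sum_{p=0}^{r}\sum_{j=0}^{2r+1-2p}(-1)^{j+p}\varrho^{p}\,c_j^{[r,p]}\,x^{2r+1-2p-j}y^{j},$$ where $[s]_{q^2}=\frac{q^{2s}-q^{-2s}}{q^2-q^{-2}}$ and $\frac{[2s]_{q^2}}{[s]_{q^2}}=q^{2s}+q^{-2s}$ are understood as Laurent polynomials in $q$, then evaluated at $q=e^{\mathrm i\pi/N}$. *)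

theory Defs
  imports
    Complex_Main
    "HOL-Library.Poly_Mapping"
    "HOL-Library.Set_Algebras"
    "HOL-Computational_Algebra.Polynomial"
begin

section \<open>Cyclic tridiagonal pairs\<close>

definition eigenspace ::
    "(complex \<Rightarrow> 'v \<Rightarrow> 'v) \<Rightarrow> ('v::ab_group_add \<Rightarrow> 'v) \<Rightarrow> complex \<Rightarrow> 'v set" where
  "eigenspace scale C \<mu> = {v. C v = scale \<mu> v}"

definition eigenvalue ::
    "(complex \<Rightarrow> 'v \<Rightarrow> 'v) \<Rightarrow> ('v::ab_group_add \<Rightarrow> 'v) \<Rightarrow> complex \<Rightarrow> bool" where
  "eigenvalue scale C \<mu> \<longleftrightarrow> (\<exists>v. v \<noteq> 0 \<and> C v = scale \<mu> v)"

definition eigenspaces ::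
    "(complex \<Rightarrow> 'v \<Rightarrow> 'v) \<Rightarrow> ('v::ab_group_add \<Rightarrow> 'v) \<Rightarrow> 'v set set" where
  "eigenspaces scale C = {eigenspace scale C \<mu> |\<mu>. eigenvalue scale C \<mu>}"

definition diagonalizable ::
    "(complex \<Rightarrow> 'v \<Rightarrow> 'v) \<Rightarrow> ('v::ab_group_add \<Rightarrow> 'v) \<Rightarrow> bool" where
  "diagonalizable scale C \<longleftrightarrow>
     (\<exists>B. \<not> module.dependent scale B \<and> module.span scale B = UNIV \<and>
          (\<forall>v\<in>B. \<exists>\<mu>. C v = scale \<mu> v))"

text \<open>
  The index set of an ordering is the integers modulo \<open>N\<close>, represented by \<open>{0..<int N}\<close>;
  \<open>V\<close> is irrelevant outside this set. An ordering enumerates each eigenspace exactly once.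
  The sum of subspaces is the elementwise sum of sets.
\<close>

definition standard_ordering ::
    "(complex \<Rightarrow> 'v \<Rightarrow> 'v) \<Rightarrow> nat \<Rightarrow> ('v::ab_group_add \<Rightarrow> 'v) \<Rightarrow> ('v \<Rightarrow> 'v)
      \<Rightarrow> (int \<Rightarrow> 'v set) \<Rightarrow> bool" where
  "standard_ordering scale N C D V \<longleftrightarrow>
     bij_betw V {0..<int N} (eigenspaces scale C) \<and>
     (\<forall>p\<in>{0..<int N}. D ` V p \<subseteq> V ((p - 1) mod int N) + V p + V ((p + 1) mod int N))"

definition cyclic_tridiagonal_pair ::
    "(complex \<Rightarrow> 'v \<Rightarrow> 'v) \<Rightarrow> nat \<Rightarrow> ('v::ab_group_add \<Rightarrow> 'v) \<Rightarrow> ('v \<Rightarrow> 'v) \<Rightarrow> bool" where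
  "cyclic_tridiagonal_pair scale N C D \<longleftrightarrow>
     Vector_Spaces.linear scale scale C \<and> Vector_Spaces.linear scale scale D \<and>
     diagonalizable scale C \<and> diagonalizable scale D \<and>
     (\<exists>V. standard_ordering scale N C D V) \<and>
     (\<exists>V. standard_ordering scale N D C V) \<and>
     \<not> (\<exists>W. module.subspace scale W \<and> W \<noteq> {0} \<and> W \<noteq> UNIV \<and> C ` W \<subseteq> W \<and> D ` W \<subseteq> W)"


section \<open>Laurent polynomials in \<open>q\<close>\<close>

text \<open>Finitely supported functions on the exponents, with the convolution product.\<close>

type_synonym laurent = "int \<Rightarrow>\<^sub>0 complex"

definition q_pow :: "int \<Rightarrow> laurent" where
  "q_pow k = Poly_Mapping.single k 1"

definition laurent_eval :: "complex \<Rightarrow> laurent \<Rightarrow> complex" where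
  "laurent_eval z f = (\<Sum>k\<in>Poly_Mapping.keys f. Poly_Mapping.lookup f k * z powi k)"

text \<open>
  The \<open>q\<^sup>2\<close>-integer \<open>[s]\<close> is \<open>(q^(2s) - q^(-2s)) / (q^2 - q^(-2))\<close>; the quotient is
  taken in Laurent polynomials, so that it can be evaluated where the denominator vanishes.
\<close>

definition q2_int :: "nat \<Rightarrow> laurent" where
  "q2_int s = (\<Sum>k<s. q_pow (2 * (int s - 1 - 2 * int k)))"

lemma q_pow_mult: "q_pow a * q_pow b = q_pow (a + b)"
  by (simp add: q_pow_def mult_single)

lemma q2_int_quotient:
  "q2_int s * (q_pow 2 - q_pow (-2)) = q_pow (2 * int s) - q_pow (- 2 * int s)"
proof -
  define f where "f k = q_pow (2 * int s - 4 * int k)" for k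
  have "q2_int s * (q_pow 2 - q_pow (-2)) = (\<Sum>k<s. f k - f (Suc k))"
    unfolding q2_int_def sum_distrib_right f_def
    by (intro sum.cong refl) (simp add: right_diff_distrib q_pow_mult algebra_simps)
  also have "\<dots> = f 0 - f s"
    by (rule sum_lessThan_telescope')
  finally show ?thesis
    by (simp add: f_def)
qed

lemma q2_int_double: "q2_int (2 * s) = q2_int s * (q_pow (2 * int s) + q_pow (- 2 * int s))"
proof -
  let ?d = "q_pow 2 - q_pow (-2)"
  have nz: "?d \<noteq> 0"
  proof
    assume "?d = 0"
    then have "Poly_Mapping.lookup ?d 2 = 0"
      by simp
    then show False
      by (simp add: q_pow_def lookup_minus lookup_single)
  qed
  have "q2_int s * (q_pow (2 * int s) + q_pow (- 2 * int s)) * ?d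
      = (q2_int s * ?d) * (q_pow (2 * int s) + q_pow (- 2 * int s))"
    by (simp only: mult_ac)
  also have "\<dots> = (q_pow (2 * int s) - q_pow (- 2 * int s)) * (q_pow (2 * int s) + q_pow (- 2 * int s))"
    by (simp only: q2_int_quotient)
  also have "\<dots> = q2_int (2 * s) * ?d"
    unfolding q2_int_quotient by (simp add: algebra_simps q_pow_mult)
  finally show ?thesis
    using nz by simp
qed


section \<open>The coefficients of the higher-order relations\<close>

text \<open>
  Polynomials in \<open>\<rho>\<close>, \<open>y\<close>, \<open>x\<close> over the Laurent polynomials are iterated univariate ones,
  with \<open>x\<close> innermost and \<open>\<rho>\<close> outermost.
\<close>

type_synonym laurent_poly3 = "laurent poly poly poly"

definition cst :: "laurent \<Rightarrow> laurent_poly3" where "cst a = [:[:[:a:]:]:]"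
definition var_x :: laurent_poly3 where "var_x = [:[:[:0, 1:]:]:]"
definition var_y :: laurent_poly3 where "var_y = [:[:0, 1:]:]"
definition var_rho :: laurent_poly3 where "var_rho = [:0, 1:]"

definition dg_poly :: "nat \<Rightarrow> laurent_poly3" where
  "dg_poly r = (var_x - var_y) *
     (\<Prod>s=1..r. var_x ^ 2 - cst (q_pow (2 * int s) + q_pow (- 2 * int s)) * var_x * var_y
                 + var_y ^ 2 - cst ((q2_int s) ^ 2) * var_rho)"

text \<open>
  \<open>dg_coeff r p j\<close> is the coefficient of \<open>\<rho>^p x^(2r+1-2p-j) y^j\<close> up to the sign
  \<open>(-1)^(j+p)\<close>; \<open>dg_poly_expansion\<close> below confirms that these are the only monomials.
\<close>

definition dg_coeff :: "nat \<Rightarrow> nat \<Rightarrow> nat \<Rightarrow> laurent" where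
  "dg_coeff r p j =
     (-1) ^ (j + p) * coeff (coeff (coeff (dg_poly r) p) j) (2 * r + 1 - 2 * p - j)"

definition weighted_homogeneous :: "nat \<Rightarrow> laurent_poly3 \<Rightarrow> bool" where
  "weighted_homogeneous d P \<longleftrightarrow>
     (\<forall>p j i. coeff (coeff (coeff P p) j) i \<noteq> 0 \<longrightarrow> 2 * p + j + i = d)"

lemma weighted_homogeneous_add:
  "weighted_homogeneous d P \<Longrightarrow> weighted_homogeneous d Q \<Longrightarrow> weighted_homogeneous d (P + Q)"
  unfolding weighted_homogeneous_def coeff_add by (metis add.right_neutral)

lemma weighted_homogeneous_diff:
  "weighted_homogeneous d P \<Longrightarrow> weighted_homogeneous d Q \<Longrightarrow> weighted_homogeneous d (P - Q)"
  unfolding weighted_homogeneous_def coeff_diff by (metis diff_zero)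

lemma weighted_homogeneous_mult:
  assumes "weighted_homogeneous d P" "weighted_homogeneous e Q"
  shows "weighted_homogeneous (d + e) (P * Q)"
  unfolding weighted_homogeneous_def
proof (intro allI impI)
  fix p j i
  assume "coeff (coeff (coeff (P * Q) p) j) i \<noteq> 0"
  then have nz: "(\<Sum>a\<le>p. \<Sum>b\<le>j. \<Sum>c\<le>i. coeff (coeff (coeff P a) b) c *
      coeff (coeff (coeff Q (p - a)) (j - b)) (i - c)) \<noteq> 0"
    by (simp add: coeff_mult coeff_sum)
  obtain a where a: "a \<le> p" "(\<Sum>b\<le>j. \<Sum>c\<le>i. coeff (coeff (coeff P a) b) c *
      coeff (coeff (coeff Q (p - a)) (j - b)) (i - c)) \<noteq> 0"
    using sum.not_neutral_contains_not_neutral[OF nz] by auto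
  obtain b where b: "b \<le> j" "(\<Sum>c\<le>i. coeff (coeff (coeff P a) b) c *
      coeff (coeff (coeff Q (p - a)) (j - b)) (i - c)) \<noteq> 0"
    using sum.not_neutral_contains_not_neutral[OF a(2)] by auto
  obtain c where c: "c \<le> i" "coeff (coeff (coeff P a) b) c *
      coeff (coeff (coeff Q (p - a)) (j - b)) (i - c) \<noteq> 0"
    using sum.not_neutral_contains_not_neutral[OF b(2)] by auto
  from c(2) have "2 * a + b + c = d" "2 * (p - a) + (j - b) + (i - c) = e"
    using assms unfolding weighted_homogeneous_def by auto
  with a(1) b(1) c(1) show "2 * p + j + i = d + e"
    by linarith
qed

lemma weighted_homogeneous_gens:
  "weighted_homogeneous 0 (cst a)" "weighted_homogeneous 1 var_x"
  "weighted_homogeneous 1 var_y" "weighted_homogeneous 2 var_rho"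
  by (auto simp: weighted_homogeneous_def cst_def var_x_def var_y_def var_rho_def
      coeff_pCons one_pCons split: nat.splits if_splits)

lemma weighted_homogeneous_dg_poly: "weighted_homogeneous (2 * r + 1) (dg_poly r)"
proof (induction r)
  case 0
  show ?case
    using weighted_homogeneous_diff[OF weighted_homogeneous_gens(2,3)] by (simp add: dg_poly_def)
next
  case (Suc r)
  note m = weighted_homogeneous_mult and g = weighted_homogeneous_gens
  have "weighted_homogeneous 2 (var_x ^ 2)" "weighted_homogeneous 2 (var_y ^ 2)"
    "weighted_homogeneous 2 (cst a * var_x * var_y)" "weighted_homogeneous 2 (cst a * var_rho)" for a
    using m[OF g(2) g(2)] m[OF g(3) g(3)] m[OF m[OF g(1)[of a] g(2)] g(3)] m[OF g(1)[of a] g(4)]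
    by (simp_all add: power2_eq_square numeral_2_eq_2)
  then have "weighted_homogeneous 2 (var_x ^ 2 - cst a * var_x * var_y + var_y ^ 2 - cst b * var_rho)"
    for a b
    by (intro weighted_homogeneous_add weighted_homogeneous_diff)
  from m[OF Suc.IH this] show ?case
    by (simp add: dg_poly_def mult.assoc)
qed

lemma monomial_coeff:
  "coeff (coeff (coeff (cst c * var_rho ^ p * var_x ^ i * var_y ^ j) p') j') i' =
     (if p' = p \<and> j' = j \<and> i' = i then c else 0)"
proof -
  have x: "var_x ^ i = [:[:monom 1 i:]:]"
    unfolding var_x_def by (induction i) (auto simp: monom_Suc monom_eq_1 simp flip: one_pCons)
  have y: "var_y ^ j = [:monom 1 j:]"
    unfolding var_y_def by (induction j) (auto simp: monom_Suc monom_eq_1 simp flip: one_pCons)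
  have r: "var_rho ^ p = monom 1 p"
    unfolding var_rho_def by (induction p) (auto simp: monom_Suc monom_eq_1 simp flip: one_pCons)
  have "cst c * var_rho ^ p * var_x ^ i * var_y ^ j =
      [:[:[:c:]:]:] * [:[:monom 1 i:]:] * [:monom 1 j:] * monom 1 p"
    by (simp add: x y r cst_def mult_ac)
  also have "\<dots> = monom (monom (monom c i) j) p"
    by (simp add: smult_monom)
  finally show ?thesis
    by auto
qed

lemma dg_poly_expansion:
  "dg_poly r = (\<Sum>p=0..r. \<Sum>j=0..2*r+1-2*p.
     (-1) ^ (j + p) * cst (dg_coeff r p j) * var_rho ^ p * var_x ^ (2*r+1-2*p-j) * var_y ^ j)"
proof (intro poly_eqI)
  fix p j i
  let ?c = "\<lambda>p j. coeff (coeff (coeff (dg_poly r) p) j) (2*r+1-2*p-j)"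
  have cst: "(-1) ^ (l + k) * cst (dg_coeff r k l) = cst (?c k l)" for k l
  proof -
    have "cst ((-1) ^ n * a) = (-1) ^ n * cst a" for n a
      by (cases "even n") (auto simp: cst_def)
    then have "(-1) ^ (l + k) * cst (dg_coeff r k l) = (-1) ^ (l + k) * ((-1) ^ (l + k) * cst (?c k l))"
      by (simp add: dg_coeff_def)
    then show ?thesis
      by (simp flip: mult.assoc power_mult_distrib)
  qed
  have "coeff (coeff (coeff (\<Sum>p=0..r. \<Sum>j=0..2*r+1-2*p.
      (-1) ^ (j + p) * cst (dg_coeff r p j) * var_rho ^ p * var_x ^ (2*r+1-2*p-j) * var_y ^ j) p) j) i
    = (\<Sum>k=0..r. \<Sum>l=0..2*r+1-2*k. if p = k \<and> j = l \<and> i = 2*r+1-2*k-l then ?c k l else 0)"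
    by (simp only: cst coeff_sum monomial_coeff)
  also have "\<dots> = (\<Sum>k=0..r. \<Sum>l=0..2*r+1-2*k.
      if p = k then (if j = l then (if i = 2*r+1-2*k-l then ?c k l else 0) else 0) else 0)"
    by (intro sum.cong refl) auto
  also have "\<dots> = (\<Sum>k=0..r. if p = k then (\<Sum>l=0..2*r+1-2*k.
      if j = l then (if i = 2*r+1-2*k-l then ?c k l else 0) else 0) else 0)"
    by (rule sum.cong[OF refl]) (simp only: if_True if_False sum.neutral_const split: if_split, simp)
  also have "\<dots> = (if p \<le> r \<and> j \<le> 2*r+1-2*p \<and> i = 2*r+1-2*p-j then ?c p j else 0)"
    by (simp add: sum.delta)
  also have "\<dots> = coeff (coeff (coeff (dg_poly r) p) j) i"
  proof (cases "coeff (coeff (coeff (dg_poly r) p) j) i = 0")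
    case False
    with weighted_homogeneous_dg_poly[of r] have "2 * p + j + i = 2 * r + 1"
      by (auto simp: weighted_homogeneous_def)
    then have "p \<le> r \<and> j \<le> 2*r+1-2*p \<and> i = 2*r+1-2*p-j"
      by linarith
    then show ?thesis
      by simp
  qed auto
  finally show "coeff (coeff (coeff (dg_poly r) p) j) i = coeff (coeff (coeff (\<Sum>p=0..r. \<Sum>j=0..2*r+1-2*p.
      (-1) ^ (j + p) * cst (dg_coeff r p j) * var_rho ^ p * var_x ^ (2*r+1-2*p-j) * var_y ^ j) p) j) i"
    by simp
qed

end

theory Submission
  imports Defs
begin

text \<open>
  If \<open>v\<close> lies in the eigenspace \<open>V\<^sub>t\<close> of \<open>W\<^sub>0\<close>, then \<open>W\<^sub>1\<^sup>r v\<close> lies in the sum of the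
  \<open>V\<^sub>s\<close> with \<open>s = t + k\<close>, \<open>\<bar>k\<bar> \<le> r\<close>. On the component in \<open>V\<^sub>s\<close> the left-hand side of the relation acts
  as multiplication by the defining polynomial of the coefficients, evaluated at
  \<open>x = \<theta>\<^sub>s\<close>, \<open>y = \<theta>\<^sub>t\<close>. Its factors vanish at these pairs: \<open>x - y\<close> for \<open>k = 0\<close>, and the
  \<open>s\<close>-th quadratic factor for \<open>k = \<plusminus>s\<close>.
\<close>

section \<open>Evaluation homomorphisms\<close>

text \<open>A predicate on functions, so that one lemma can lift it through the three nested
  polynomial rings in turn.\<close>

definition unital_ring_hom :: "('a::comm_ring_1 \<Rightarrow> 'b::comm_ring_1) \<Rightarrow> bool" where
  "unital_ring_hom h \<longleftrightarrow>
     h 0 = 0 \<and> h 1 = 1 \<and> (\<forall>a b. h (a + b) = h a + h b) \<and> (\<forall>a b. h (a * b) = h a * h b)"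

lemma unital_ring_homD:
  assumes "unital_ring_hom h"
  shows "h 0 = 0" "h 1 = 1" "h (a + b) = h a + h b" "h (a * b) = h a * h b"
    "h (- a) = - h a" "h (a - b) = h a - h b" "h (a ^ n) = h a ^ n"
    "h (sum f A) = (\<Sum>i\<in>A. h (f i))" "h (prod f A) = (\<Prod>i\<in>A. h (f i))"
proof -
  have h: "h 0 = 0" "h 1 = 1" "\<And>a b. h (a + b) = h a + h b" "\<And>a b. h (a * b) = h a * h b"
    using assms by (auto simp: unital_ring_hom_def)
  show "h 0 = 0" "h 1 = 1" "h (a + b) = h a + h b" "h (a * b) = h a * h b"
    by (rule h)+
  have m: "h (- a) = - h a" for a
    using h(3)[of a "- a"] h(1) by (simp add: eq_neg_iff_add_eq_0 add.commute)
  show "h (- a) = - h a"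
    by (rule m)
  show "h (a - b) = h a - h b"
    using h(3)[of a "- b"] m[of b] by simp
  show "h (a ^ n) = h a ^ n"
    by (induction n) (simp_all add: h)
  show "h (sum f A) = (\<Sum>i\<in>A. h (f i))"
    by (induction A rule: infinite_finite_induct) (simp_all add: h)
  show "h (prod f A) = (\<Prod>i\<in>A. h (f i))"
    by (induction A rule: infinite_finite_induct) (simp_all add: h)
qed

text \<open>Applying \<open>h\<close> to the coefficients and substituting \<open>x\<close> obeys
  the Horner recursion \<open>E_pCons\<close>; additivity and multiplicativity follow from it by
  induction.\<close>

lemma unital_ring_hom_poly_map_poly:
  assumes "unital_ring_hom h"
  shows "unital_ring_hom (\<lambda>p. poly (map_poly h p) x)"
proof -
  note h = unital_ring_homD[OF assms]
  define E where "E p = poly (map_poly h p) x" for p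
  have E_pCons: "E (pCons a p) = h a + x * E p" for a p
    by (simp add: E_def map_poly_pCons h)
  have E_0: "E 0 = 0"
    by (simp add: E_def)
  have E_add: "E (p + p') = E p + E p'" for p p'
    by (induction p p' rule: poly_induct2) (simp_all add: E_0 E_pCons h algebra_simps)
  have E_smult: "E (smult a p) = h a * E p" for a p
    by (induction p) (simp_all add: E_0 E_pCons h algebra_simps)
  have "E (p * p') = E p * E p'" for p p'
    by (induction p) (simp_all add: E_0 E_pCons E_add E_smult h algebra_simps)
  moreover have "E 1 = 1"
    by (simp add: one_pCons E_pCons E_0 h)
  ultimately show ?thesis
    using E_0 E_add unfolding unital_ring_hom_def E_def by blast
qed

text \<open>The defining sum runs over the support of \<open>f\<close>; comparing several Laurent
  polynomials needs a common index set.\<close>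

lemma laurent_eval_superset:
  assumes "finite S" "Poly_Mapping.keys f \<subseteq> S"
  shows "laurent_eval z f = (\<Sum>k\<in>S. Poly_Mapping.lookup f k * z powi k)"
  unfolding laurent_eval_def using assms
  by (intro sum.mono_neutral_left) (auto simp: in_keys_iff)

lemma laurent_eval_add: "laurent_eval z (f + g) = laurent_eval z f + laurent_eval z g"
proof -
  let ?S = "Poly_Mapping.keys f \<union> Poly_Mapping.keys g"
  have "laurent_eval z h = (\<Sum>k\<in>?S. Poly_Mapping.lookup h k * z powi k)"
    if "h \<in> {f, g, f + g}" for h
    using that keys_add[of f g] by (intro laurent_eval_superset) auto
  then show ?thesis
    by (simp add: lookup_add sum.distrib distrib_right)
qed

lemma laurent_eval_single: "laurent_eval z (Poly_Mapping.single k a) = a * z powi k"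
  by (simp add: laurent_eval_def)

lemma laurent_induct [case_names zero add_single]:
  fixes f :: laurent
  assumes "P 0" "\<And>f k a. P f \<Longrightarrow> P (f + Poly_Mapping.single k a)"
  shows "P f"
proof (induction f rule: update_induct)
  case (update f k a)
  \<comment> \<open>The induction rule only updates at exponents \<open>k\<close> outside the
    support of \<open>f\<close>, where updating is adding a monomial.\<close>
  have "Poly_Mapping.update k a f = f + Poly_Mapping.single k a"
    using update(1)
    by (intro poly_mapping_eqI) (auto simp: lookup_update lookup_add lookup_single in_keys_iff when_def)
  with update assms(2) show ?case
    by simp
qed (rule assms(1))

lemma unital_ring_hom_laurent_eval:
  assumes "z \<noteq> 0"
  shows "unital_ring_hom (laurent_eval z)"
proof -
  have zero: "laurent_eval z 0 = 0"
    by (simp add: laurent_eval_def)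
  \<comment> \<open>Multiplicativity is reduced to products of monomials, where it is the exponent
    law for \<open>powi\<close> at nonzero \<open>z\<close>.\<close>
  have single: "laurent_eval z (Poly_Mapping.single k a * g)
      = laurent_eval z (Poly_Mapping.single k a) * laurent_eval z g" for k a g
    by (induction g rule: laurent_induct)
       (simp_all add: zero laurent_eval_add laurent_eval_single mult_single distrib_left
         power_int_add assms)
  have "laurent_eval z (f * g) = laurent_eval z f * laurent_eval z g" for f g
    by (induction f rule: laurent_induct)
       (simp_all add: zero laurent_eval_add single distrib_right)
  moreover have "laurent_eval z 1 = 1"
    by (simp add: laurent_eval_single flip: single_one)
  ultimately show ?thesis
    by (simp add: unital_ring_hom_def zero laurent_eval_add)
qed

definition laurent_poly3_eval :: "complex \<Rightarrow> complex \<Rightarrow> complex \<Rightarrow> complex \<Rightarrow> laurent_poly3 \<Rightarrow> complex" where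
  "laurent_poly3_eval z x y \<rho> P =
     poly (map_poly (\<lambda>Q. poly (map_poly (\<lambda>R. poly (map_poly (laurent_eval z) R) x) Q) y) P) \<rho>"

lemma unital_ring_hom_laurent_poly3_eval:
  "z \<noteq> 0 \<Longrightarrow> unital_ring_hom (laurent_poly3_eval z x y \<rho>)"
  unfolding laurent_poly3_eval_def
  by (intro unital_ring_hom_poly_map_poly unital_ring_hom_laurent_eval)

lemma laurent_poly3_eval_gens:
  assumes "z \<noteq> 0"
  shows "laurent_poly3_eval z x y \<rho> (cst a) = laurent_eval z a"
    "laurent_poly3_eval z x y \<rho> var_x = x"
    "laurent_poly3_eval z x y \<rho> var_y = y"
    "laurent_poly3_eval z x y \<rho> var_rho = \<rho>"
proof -
  note h0 = unital_ring_hom_laurent_eval[OF assms]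
  note h1 = unital_ring_hom_poly_map_poly[OF h0]
  note h2 = unital_ring_hom_poly_map_poly[OF h1]
  note h = unital_ring_homD(1,2)[OF h0]
  show "laurent_poly3_eval z x y \<rho> (cst a) = laurent_eval z a"
    "laurent_poly3_eval z x y \<rho> var_x = x"
    "laurent_poly3_eval z x y \<rho> var_y = y"
    "laurent_poly3_eval z x y \<rho> var_rho = \<rho>"
    by (simp_all add: laurent_poly3_eval_def cst_def var_x_def var_y_def var_rho_def
        map_poly_pCons one_pCons h)
qed

section \<open>Vanishing of the defining polynomial\<close>

text \<open>Kept as a product because \<open>z powi 2 - z powi (-2)\<close> can vanish, as it does
  at \<open>z = \<i>\<close>, the value of q for N = 2.\<close>

lemma laurent_eval_q2_int:
  assumes "z \<noteq> 0"
  shows "laurent_eval z (q2_int s) * (z powi 2 - z powi (- 2)) = z powi (2 * int s) - z powi (- 2 * int s)"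
proof -
  note h = unital_ring_homD[OF unital_ring_hom_laurent_eval[OF assms]]
  show ?thesis
    using arg_cong[OF q2_int_quotient, of "laurent_eval z" s]
    by (simp only: h) (simp add: q_pow_def laurent_eval_single)
qed

lemma laurent_poly3_eval_dg_poly:
  assumes "z \<noteq> 0"
  shows "laurent_poly3_eval z x y \<rho> (dg_poly r) = (x - y) *
     (\<Prod>s=1..r. x ^ 2 - (z powi (2 * int s) + z powi (- 2 * int s)) * x * y + y ^ 2
        - (laurent_eval z (q2_int s)) ^ 2 * \<rho>)"
proof -
  note h = unital_ring_homD[OF unital_ring_hom_laurent_eval[OF assms]]
  note h3 = unital_ring_homD[OF unital_ring_hom_laurent_poly3_eval[OF assms]]
  show ?thesis
    by (simp only: dg_poly_def h3 laurent_poly3_eval_gens[OF assms] h)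
       (simp add: q_pow_def laurent_eval_single)
qed

lemma dg_coeff_sum:
  assumes "z \<noteq> 0"
  shows "(\<Sum>p=0..r. \<Sum>j=0..2*r+1-2*p. (-1) ^ (j + p) * \<rho> ^ p * laurent_eval z (dg_coeff r p j)
      * x ^ (2*r+1-2*p-j) * y ^ j) = laurent_poly3_eval z x y \<rho> (dg_poly r)"
proof -
  note h3 = unital_ring_homD[OF unital_ring_hom_laurent_poly3_eval[OF assms]]
  show ?thesis
    by (subst dg_poly_expansion)
       (simp add: h3 laurent_poly3_eval_gens[OF assms] mult_ac)
qed

text \<open>Defined for all integers, so that a shifted index t + k needs no reduction modulo
  N.\<close>

definition theta :: "complex \<Rightarrow> complex \<Rightarrow> complex \<Rightarrow> int \<Rightarrow> complex" where
  "theta q b c t = b * q powi (2 * t) + c * q powi (- 2 * t)"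

lemma theta_mod:
  assumes "q \<noteq> 0" "q ^ (2 * N) = 1"
  shows "theta q b c (t mod int N) = theta q b c t"
proof -
  have one: "q powi (2 * int N * k) = 1" for k
  proof -
    have "q powi (2 * int N * k) = (q powi int (2 * N)) powi k"
      unfolding power_int_mult[symmetric] by simp
    then show ?thesis
      by (simp only: power_int_of_nat assms(2) power_int_1_left)
  qed
  have "2 * t = 2 * (t mod int N) + 2 * int N * (t div int N)"
    using mult_div_mod_eq[of "int N" t] by linarith
  then have "q powi (2 * t) = q powi (2 * (t mod int N))"
    by (metis one power_int_add assms(1) mult.right_neutral)
  then show ?thesis
    by (simp add: theta_def power_int_minus)
qed

text \<open>With Q = q^(2k), the quadratic form x^2 - (Q + 1/Q)xy + y^2 splits as (x - Qy)(x - y/Q).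
  At the two eigenvalues each factor loses one of the terms in b and c, and the product is -bc(Q -
  1/Q)^2, which the \<open>\<rho>\<close> term cancels.\<close>

lemma dg_poly_eval_theta:
  assumes "q \<noteq> 0" "\<bar>k\<bar> \<le> int r" "\<rho> = - b * c * (q powi 2 - q powi (- 2)) ^ 2"
  shows "laurent_poly3_eval q (theta q b c (t + k)) (theta q b c t) \<rho> (dg_poly r) = 0"
proof (cases "k = 0")
  case True
  then show ?thesis
    by (simp add: laurent_poly3_eval_dg_poly[OF assms(1)])
next
  case False
  define s where "s = nat \<bar>k\<bar>"
  have s: "s \<in> {1..r}" "int s = k \<or> int s = - k"
    using False assms(2) by (auto simp: s_def)
  define Q where "Q = q powi (2 * k)"
  define u where "u = q powi (2 * t)"
  let ?x = "theta q b c (t + k)" and ?y = "theta q b c t"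
  have nz: "Q \<noteq> 0" "u \<noteq> 0"
    using assms(1) by (auto simp: Q_def u_def)
  have x: "?x = b * u * Q + c / u / Q" and y: "?y = b * u + c / u"
    by (simp_all add: theta_def Q_def u_def power_int_add power_int_minus assms(1)
        distrib_left field_simps power_int_diff)
  \<comment> \<open>This sum and the squared difference below are symmetric under Q -> 1/Q, so the
    sign of \<open>k\<close> does not matter.\<close>
  have Qs: "q powi (2 * int s) + q powi (- 2 * int s) = Q + 1 / Q"
    using s(2) by (auto simp: Q_def power_int_minus field_simps)
  have "(q powi (2 * int s) - q powi (- 2 * int s)) ^ 2 = (Q - 1 / Q) ^ 2"
    using s(2) by (auto simp: Q_def power_int_minus field_simps power2_commute)
  \<comment> \<open>The square in \<open>\<rho>\<close> supplies the denominator of the q-integer,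
    so nothing is divided by a possibly zero number.\<close>
  moreover have "(laurent_eval q (q2_int s)) ^ 2 * \<rho>
      = - b * c * (laurent_eval q (q2_int s) * (q powi 2 - q powi (- 2))) ^ 2"
    unfolding assms(3) power_mult_distrib by (simp only: mult_ac)
  ultimately have "(laurent_eval q (q2_int s)) ^ 2 * \<rho> = - b * c * (Q - 1 / Q) ^ 2"
    by (simp only: laurent_eval_q2_int[OF assms(1)])
  moreover have "?x ^ 2 - (Q + 1 / Q) * ?x * ?y + ?y ^ 2 = (?x - Q * ?y) * (?x - ?y / Q)"
    using nz by (simp add: algebra_simps power2_eq_square)
  ultimately have "?x ^ 2 - (q powi (2 * int s) + q powi (- 2 * int s)) * ?x * ?y + ?y ^ 2
      - (laurent_eval q (q2_int s)) ^ 2 * \<rho>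
    = (?x - Q * ?y) * (?x - ?y / Q) + b * c * (Q - 1 / Q) ^ 2"
    unfolding Qs by simp
  also have "\<dots> = 0"
  proof -
    have "?x - Q * ?y = c / u * (1 / Q - Q)" "?x - ?y / Q = b * u * (Q - 1 / Q)"
      unfolding x y using nz by (simp_all add: field_simps)
    then show ?thesis
      using nz by (simp add: power2_eq_square) (simp add: algebra_simps)
  qed
  finally show ?thesis
    using s(1) by (auto simp: laurent_poly3_eval_dg_poly[OF assms(1)] intro!: prod_zero)
qed

section \<open>Action on the eigenspaces\<close>

lemma funpow_eigenvector:
  assumes "module_hom scale scale C" "C v = scale \<mu> v"
  shows "(C ^^ n) v = scale (\<mu> ^ n) v"
proof -
  interpret module_hom scale scale C by fact
  show ?thesis
    by (induction n) (simp_all add: scale assms(2) mult.commute)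
qed

lemma module_hom_funpow:
  assumes "module_hom scale scale C"
  shows "module_hom scale scale (C ^^ n)"
proof (induction n)
  case 0
  then show ?case
    using module.module_hom_id[OF module_hom.axioms(1)[OF assms]] by (simp only: funpow.simps)
next
  case (Suc n)
  from module_hom_compose[OF Suc assms] show ?case
    by (simp only: funpow.simps)
qed

text \<open>Each vector of an eigenbasis is nonzero by independence, so its eigenspace is among
  those enumerated by \<open>V\<close>.\<close>

lemma span_standard_ordering:
  assumes "module scale" "diagonalizable scale C" "standard_ordering scale N C D V"
  shows "module.span scale (\<Union>p\<in>{0..<int N}. V p) = UNIV"
proof -
  interpret module scale by fact
  obtain B where B: "\<not> dependent B" "span B = UNIV" "\<forall>v\<in>B. \<exists>\<mu>. C v = scale \<mu> v"
    using assms(2) unfolding diagonalizable_def by blast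
  have "B \<subseteq> (\<Union>p\<in>{0..<int N}. V p)"
  proof
    fix v assume v: "v \<in> B"
    then obtain \<mu> where \<mu>: "C v = scale \<mu> v"
      using B(3) by blast
    have "v \<noteq> 0"
      using v B(1) dependent_zero by auto
    with \<mu> have "eigenspace scale C \<mu> \<in> eigenspaces scale C"
      by (auto simp: eigenspaces_def eigenvalue_def)
    then obtain p where "p \<in> {0..<int N}" "V p = eigenspace scale C \<mu>"
      using assms(3) unfolding standard_ordering_def bij_betw_def by (metis imageE)
    with \<mu> show "v \<in> (\<Union>p\<in>{0..<int N}. V p)"
      by (auto simp: eigenspace_def)
  qed
  from span_mono[OF this] B(2) show ?thesis
    by auto
qed

text \<open>Each application of \<open>D\<close> widens the window of shifts by one on both sides.
  The shifts are integers, reduced only inside \<open>V\<close>, so a window that wraps around the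
  cycle needs no separate case.\<close>

lemma funpow_standard_ordering:
  assumes "module_hom scale scale D" "standard_ordering scale N C D V" "N > 0" "v \<in> V (t mod int N)"
  shows "(D ^^ n) v \<in> module.span scale (\<Union>k\<in>{- int n..int n}. V ((t + k) mod int N))"
proof -
  interpret D: module_hom scale scale D by fact
  show ?thesis
  proof (induction n)
    case 0
    then show ?case
      using assms(4) by (auto intro: D.m1.span_base)
  next
    case (Suc n)
    let ?U = "\<lambda>n. \<Union>k\<in>{- int n..int n}. V ((t + k) mod int N)"
    have step: "D w \<in> D.m1.span (?U (Suc n))" if w: "w \<in> ?U n" for w
    proof -
      obtain k where k: "k \<in> {- int n..int n}" "w \<in> V ((t + k) mod int N)"
        using w by blast
      have "(t + k) mod int N \<in> {0..<int N}"
        using assms(3) by simp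
      then have "D w \<in> V (((t + k) mod int N - 1) mod int N) + V ((t + k) mod int N)
          + V (((t + k) mod int N + 1) mod int N)"
        using assms(2) k(2) unfolding standard_ordering_def by blast
      then have "D w \<in> V ((t + (k - 1)) mod int N) + V ((t + k) mod int N) + V ((t + (k + 1)) mod int N)"
        by (simp add: mod_simps algebra_simps)
      then obtain a b c where D: "D w = a + b + c" and abc: "a \<in> V ((t + (k - 1)) mod int N)"
        "b \<in> V ((t + k) mod int N)" "c \<in> V ((t + (k + 1)) mod int N)"
        by (auto simp: set_plus_def)
      have "k - 1 \<in> {- int (Suc n)..int (Suc n)}" "k \<in> {- int (Suc n)..int (Suc n)}"
        "k + 1 \<in> {- int (Suc n)..int (Suc n)}"
        using k(1) by auto
      with abc have "a \<in> ?U (Suc n)" "b \<in> ?U (Suc n)" "c \<in> ?U (Suc n)"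
        by blast+
      then show ?thesis
        unfolding D by (intro D.m1.span_add D.m1.span_base)
    qed
    have "D ` D.m1.span (?U n) = D.m1.span (D ` ?U n)"
      by (simp only: D.span_image)
    also have "\<dots> \<subseteq> D.m1.span (?U (Suc n))"
      using step by (intro D.m1.span_minimal D.m1.subspace_span) blast
    finally show ?case
      using Suc by auto
  qed
qed

text \<open>Treats one ordered pair; exchanging the two maps, with their orderings and parameters,
  gives the other relation.\<close>

lemma higher_order_dolan_grady:
  fixes scale :: "complex \<Rightarrow> 'v::ab_group_add \<Rightarrow> 'v" and C D :: "'v \<Rightarrow> 'v"
  assumes q: "q \<noteq> 0" "q ^ (2 * N) = 1" and N: "N > 0"
    and C: "module_hom scale scale C" and D: "module_hom scale scale D"
    and diag: "diagonalizable scale C" and V: "standard_ordering scale N C D V"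
    and eig: "\<And>t v. t \<in> {0..<int N} \<Longrightarrow> v \<in> V t \<Longrightarrow> C v = scale (theta q b c t) v"
    and \<rho>: "\<rho> = - b * c * (q powi 2 - q powi (-2)) ^ 2"
  shows "(\<Sum>p=0..r. \<Sum>j=0..2*r+1-2*p.
            scale ((-1) ^ (j + p) * \<rho> ^ p * laurent_eval q (dg_coeff r p j))
              ((C ^^ (2*r+1-2*p-j)) ((D ^^ r) ((C ^^ j) v)))) = 0"
    (is "?L v = 0")
proof -
  interpret C: module_hom scale scale C by fact
  interpret module_pair scale scale ..
  let ?a = "\<lambda>p j. (-1) ^ (j + p) * \<rho> ^ p * laurent_eval q (dg_coeff r p j)"
  note homC = module_hom_funpow[OF C] and homD = module_hom_funpow[OF D]
  have "module_hom scale scale (\<lambda>v. (C ^^ i) ((D ^^ r) ((C ^^ j) v)))" for i j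
    using module_hom_compose[OF module_hom_compose[OF homC homD] homC] by (simp add: comp_def)
  then have hom_L: "module_hom scale scale ?L"
    by (intro module_hom_sum module_hom_scale conjI C.m1.module_axioms)
  have "?L v = 0" if t: "t \<in> {0..<int N}" and v: "v \<in> V t" for t v
  proof -
    let ?\<theta> = "theta q b c"
    \<comment> \<open>On \<open>V t\<close> the inner powers of \<open>C\<close> become powers of
      the eigenvalue and move out by linearity, which leaves a polynomial in \<open>C\<close>
      applied to \<open>(D ^^ r) v\<close>.\<close>
    let ?F = "\<lambda>w. \<Sum>p=0..r. \<Sum>j=0..2*r+1-2*p. scale (?a p j * ?\<theta> t ^ j) ((C ^^ (2*r+1-2*p-j)) w)"
    have hom_F: "module_hom scale scale ?F"
      by (intro module_hom_sum module_hom_scale module_hom_funpow C conjI C.m1.module_axioms)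
    interpret F: module_hom scale scale ?F by fact
    have "?F w = 0" if w: "w \<in> (\<Union>k\<in>{- int r..int r}. V ((t + k) mod int N))" for w
    proof -
      obtain k where "k \<in> {- int r..int r}" and w_in: "w \<in> V ((t + k) mod int N)"
        using w by blast
      then have k: "\<bar>k\<bar> \<le> int r"
        by auto
      \<comment> \<open>\<open>eig\<close> gives the eigenvalue at the reduced index; periodicity of
        \<open>theta\<close> removes the reduction.\<close>
      have "C w = scale (?\<theta> (t + k)) w"
        using eig[OF _ w_in] N by (simp add: theta_mod[OF q])
      then have "?F w = scale (\<Sum>p=0..r. \<Sum>j=0..2*r+1-2*p.
          ?a p j * ?\<theta> (t + k) ^ (2*r+1-2*p-j) * ?\<theta> t ^ j) w"
        by (simp add: funpow_eigenvector[OF C] C.m1.scale_sum_left mult_ac)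
      then show ?thesis
        by (simp only: dg_coeff_sum[OF q(1)] dg_poly_eval_theta[OF q(1) k \<rho>] C.m1.scale_zero_left)
    qed
    moreover have "(D ^^ r) v \<in> C.m1.span (\<Union>k\<in>{- int r..int r}. V ((t + k) mod int N))"
      using funpow_standard_ordering[OF D V N, of v t r] t v by simp
    ultimately have "?F ((D ^^ r) v) = 0"
      using F.eq_0_on_span by blast
    moreover have "?L v = ?F ((D ^^ r) v)"
    proof -
      have "(D ^^ r) ((C ^^ j) v) = scale (?\<theta> t ^ j) ((D ^^ r) v)" for j
        using funpow_eigenvector[OF C eig[OF t v]] module_hom.scale[OF homD] by metis
      then show ?thesis
        by (simp add: module_hom.scale[OF homC])
    qed
    ultimately show ?thesis
      by simp
  qed
  \<comment> \<open>The left-hand side is linear in \<open>v\<close> and vanishes on every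
    \<open>V t\<close>, and these span the whole space.\<close>
  then show ?thesis
    using module_hom.eq_0_on_span[OF hom_L, of "\<Union>p\<in>{0..<int N}. V p" v]
      span_standard_ordering[OF C.m1.module_axioms diag V] by blast
qed

theorem proposition4p2p2:
  fixes N r :: nat
    and q b c b' c' \<rho> \<rho>' :: complex
    and scale :: "complex \<Rightarrow> 'v::ab_group_add \<Rightarrow> 'v"
    and Basis :: "'v set"
    and W0 W1 :: "'v \<Rightarrow> 'v"
    and V V' :: "int \<Rightarrow> 'v set"
  assumes N: "N \<ge> 2"
    and q: "q = exp (\<i> * of_real pi / of_nat N)"
    and fin_dim: "finite_dimensional_vector_space scale Basis"
    and pair: "cyclic_tridiagonal_pair scale N W0 W1"
    and V: "standard_ordering scale N W0 W1 V"
    and V': "standard_ordering scale N W1 W0 V'"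
    and eig: "\<And>t v. t \<in> {0..<int N} \<Longrightarrow> v \<in> V t \<Longrightarrow>
               W0 v = scale (b * q powi (2 * t) + c * q powi (- 2 * t)) v"
    and eig': "\<And>t v. t \<in> {0..<int N} \<Longrightarrow> v \<in> V' t \<Longrightarrow>
               W1 v = scale (b' * q powi (2 * t) + c' * q powi (- 2 * t)) v"
    and \<rho>: "\<rho> = - b * c * (q powi 2 - q powi (-2)) ^ 2"
    and \<rho>': "\<rho>' = - b' * c' * (q powi 2 - q powi (-2)) ^ 2"
    and r: "1 \<le> r" "r \<le> N - 1"
  shows "(\<forall>v. (\<Sum>p=0..r. \<Sum>j=0..2*r+1-2*p.
            scale ((-1) ^ (j + p) * \<rho> ^ p * laurent_eval q (dg_coeff r p j))
              ((W0 ^^ (2*r+1-2*p-j)) ((W1 ^^ r) ((W0 ^^ j) v)))) = 0) \<and>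
         (\<forall>v. (\<Sum>p=0..r. \<Sum>j=0..2*r+1-2*p.
            scale ((-1) ^ (j + p) * \<rho>' ^ p * laurent_eval q (dg_coeff r p j))
              ((W1 ^^ (2*r+1-2*p-j)) ((W0 ^^ r) ((W1 ^^ j) v)))) = 0)"
proof -
  interpret finite_dimensional_vector_space scale Basis by (rule fin_dim)
  have hom: "module_hom scale scale W0" "module_hom scale scale W1"
    and diag: "diagonalizable scale W0" "diagonalizable scale W1"
    using pair by (auto simp: cyclic_tridiagonal_pair_def module_hom_iff_linear)
  \<comment> \<open>This root of unity property makes the eigenvalue formula N-periodic.\<close>
  have "q ^ (2 * N) = exp (of_nat (2 * N) * (\<i> * of_real pi / of_nat N))"
    by (simp only: q exp_of_nat_mult)
  also have "of_nat (2 * N) * (\<i> * of_real pi / of_nat N) = 2 * of_real pi * \<i>"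
    using N by simp
  finally have root: "q \<noteq> 0" "q ^ (2 * N) = 1"
    by (simp_all add: q)
  have "N > 0"
    using N by simp
  note relation = higher_order_dolan_grady[OF root this]
  show ?thesis
    using relation[OF hom diag(1) V eig[folded theta_def] \<rho>]
      relation[OF hom(2,1) diag(2) V' eig'[folded theta_def] \<rho>'] by blast
qed

end
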